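(* Let $\mathcal{F}$ be an invariant decomposition on a topological space $X$. Then the Morse hyper-graph $\mathcal{G}_{\mathcal{F}}$ of $\mathcal{F}$ is a quotient space of the abstract element space $X/\langle\mathcal{F}\rangle$ and of the abstract weak element space $X/[\mathcal{F}]$. That is, every abstract element $\langle x\rangle$ and every abstract weak element $[x]$ ($x\in X$) is contained in a single member of the decomposition of $X$ consisting of the vertices $M_\lambda$ ($\lambda\in\Lambda$) and the non-empty hyper-edges $H_I$ ($I\subseteq\Lambda$), so that the quotient of $X$ by this decomposition is a quotient space of both $X/\langle\mathcal{F}\rangle$ and $X/[\mathcal{F}]$.
   Context: A decomposition $\mathcal{F}$ of a topological space $(X,\tau)$ is a family of pairwise disjoint non-empty subsets with union $X$; $\mathcal{F}(x)$ is the element containing $x$, $\mathcal{F}(A)=\bigcup_{x\in A}\mathcal{F}(x)$, and $q\colon X\to X/\mathcal{F}$ is the quotient map (quotient topology). $\mathcal{F}$ is invariant if $\mathcal{F}(U)$ is open for every open $U$. The class decomposition $\hat{\mathcal{F}}$ consists of the sets $\hat{L}=\{x\in X\mid\overline{\mathcal{F}(x)}=\overline{L}\}$, $L\in\mathcal{F}$; a set is $\hat{\mathcal{F}}$-invariant if it is a union of elements of $\hat{\mathcal{F}}$. An element $L$ is closed if $\overline{L}=L$, and proper if $\overline{L}\setminus L$ is closed; $\mathrm{Cl}(\mathcal{F})$, $\mathrm{P}(\mathcal{F})$, $\mathrm{R}(\mathcal{F})$ are the unions of the closed, non-closed proper, and non-proper elements, and $\mathcal{R}(\mathcal{F})=\mathrm{Cl}(\mathcal{F})\sqcup\mathrm{R}(\mathcal{F})$.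 The abstract element $\langle L\rangle$ of $L\in\mathcal{F}$ is the inverse image under $q$ of the connected component containing $L$ of $\{L'\in X/\mathcal{F}\mid\overline{L}\setminus L=\overline{L'}\setminus L'\}$ if $L\subseteq\mathrm{Cl}(\mathcal{F})\sqcup\mathrm{P}(\mathcal{F})$, and of $\{L'\in X/\mathcal{F}\mid\overline{L}=\overline{L'}\}$ if $L\subseteq\mathrm{R}(\mathcal{F})$. The abstract weak element $[L]$ is defined in the same way but with the additional requirement that $L'$ be homeomorphic to $L$ in both sets. For $x\in X$ put $\langle x\rangle=\langle\mathcal{F}(x)\rangle$ and $[x]=[\mathcal{F}(x)]$. $X/\langle\mathcal{F}\rangle$ (resp. $X/[\mathcal{F}]$) is the quotient space of $X$ identifying $x,y$ when $\langle x\rangle=\langle y\rangle$ (resp. $[x]=[y]$). A point $x$ is non-maximal if there is $y\in X$ with $\overline{\mathcal{F}(x)}\subsetneq\overline{\mathcal{F}(y)}$. A point $x$ is quasi-recurrent if $\langle x\rangle$ contains a point of $\mathcal{R}(\mathcal{F})$ or a non-maximal point; $\mathcal{Q}(\mathcal{F})$ is the set of quasi-recurrent points. Let $\mathcal{M}=\{M_\lambda\}_{\lambda\in\Lambda}$ be the set of inverse images under $q$ of the connected components of $q(\mathcal{Q}(\mathcal{F}))\subseteq X/\mathcal{F}$ (pairwise disjoint $\hat{\mathcal{F}}$-invariant non-empty sets). For $I\subseteq\Lambda$, the hyper-edge $H_I$ is the set of $x\in X\setminus\bigsqcup_\lambda M_\lambda$ for which there are disjoint $\hat{\mathcal{F}}$-invariant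 non-empty subsets $(C_i)_{i\in I}$ of $\overline{\mathcal{F}(x)}\setminus\mathcal{F}(x)$ with $C_i\subseteq M_i$ and $\overline{\mathcal{F}(x)}\setminus\mathcal{F}(x)=\bigsqcup_{i\in I}C_i$. The Morse hyper-graph of $\mathcal{F}$ is $\mathcal{G}_{\mathcal{F}}=(V,H)$ with $V=\{M_\lambda\mid\lambda\in\Lambda\}$, $H=\{\{M_i\}_{i\in I}\mid H_I\ne\emptyset,\ I\subseteq\Lambda\}$; it is known to exist, i.e. $X\setminus\bigsqcup_\lambda M_\lambda=\bigsqcup_{I\subseteq\Lambda}H_I$. As a space it is regarded as the quotient of $X$ whose points are the sets $M_\lambda$ and the non-empty sets $H_I$. *)

theory Defs
  imports "HOL-Analysis.Analysis" "HOL-Library.Disjoint_Sets"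
begin

section \<open>Quotient spaces\<close>

text \<open>The quotient of \<open>X\<close> that identifies \<open>x\<close> and \<open>y\<close> when \<open>f x = f y\<close>. The class of \<open>x\<close> is
  represented by the value \<open>f x\<close>, and the image carries the quotient (final) topology.\<close>

definition quotient_topology :: "'a topology \<Rightarrow> ('a \<Rightarrow> 'b) \<Rightarrow> 'b topology" where
  "quotient_topology X f =
     topology (\<lambda>U. U \<subseteq> f ` topspace X \<and> openin X {x \<in> topspace X. f x \<in> U})"

lemma openin_quotient_topology:
  "openin (quotient_topology X f) U \<longleftrightarrow>
     U \<subseteq> f ` topspace X \<and> openin X {x \<in> topspace X. f x \<in> U}"
proof -
  let ?P = "\<lambda>U. U \<subseteq> f ` topspace X \<and> openin X {x \<in> topspace X. f x \<in> U}"
  have inter: "?P (S \<inter> T)" if "?P S" "?P T" for S T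
  proof -
    have eq: "{x \<in> topspace X. f x \<in> S \<inter> T} =
        {x \<in> topspace X. f x \<in> S} \<inter> {x \<in> topspace X. f x \<in> T}" by blast
    show ?thesis
      unfolding eq using that by (intro conjI openin_Int le_infI1) (elim conjE, assumption)+
  qed
  have union: "?P (\<Union>K)" if "\<forall>U\<in>K. ?P U" for K
  proof -
    have eq: "{x \<in> topspace X. f x \<in> \<Union>K} = (\<Union>U\<in>K. {x \<in> topspace X. f x \<in> U})" by blast
    have "openin X {x \<in> topspace X. f x \<in> \<Union>K}"
      unfolding eq by (rule openin_Union) (use that in blast)
    moreover have "\<Union>K \<subseteq> f ` topspace X"
      by (rule Union_least) (use that in blast)
    ultimately show ?thesis by blast
  qed
  have "istopology ?P"
    unfolding istopology_def
  proof (rule conjI; intro allI impI)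
    show "?P (S \<inter> T)" if "?P S" "?P T" for S T
      by (rule inter[OF that])
    show "?P (\<Union>K)" if "\<forall>U\<in>K. ?P U" for K
      by (rule union[OF that])
  qed
  then have "openin (topology ?P) = ?P"
    by (rule topology_inverse')
  then show ?thesis
    unfolding quotient_topology_def by (rule fun_cong)
qed

lemma topspace_quotient_topology [simp]:
  "topspace (quotient_topology X f) = f ` topspace X"
proof (rule subset_antisym)
  show "topspace (quotient_topology X f) \<subseteq> f ` topspace X"
    using openin_topspace[of "quotient_topology X f"]
    unfolding openin_quotient_topology by (rule conjunct1)
  have eq: "{x \<in> topspace X. f x \<in> f ` topspace X} = topspace X" by blast
  have "openin (quotient_topology X f) (f ` topspace X)"
    unfolding openin_quotient_topology eq by (rule conjI[OF subset_refl openin_topspace])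
  then show "f ` topspace X \<subseteq> topspace (quotient_topology X f)"
    by (rule openin_subset)
qed

lemma quotient_map_quotient_topology: "quotient_map X (quotient_topology X f) f"
  unfolding quotient_map_def topspace_quotient_topology openin_quotient_topology
  by (intro conjI allI impI refl iffI) simp_all


section \<open>Decompositions\<close>

definition decomposition :: "'a topology \<Rightarrow> 'a set set \<Rightarrow> bool" where
  "decomposition X F \<longleftrightarrow> partition_on (topspace X) F"

definition element_of :: "'a set set \<Rightarrow> 'a \<Rightarrow> 'a set" where
  "element_of F x = (THE L. L \<in> F \<and> x \<in> L)"

definition saturation :: "'a set set \<Rightarrow> 'a set \<Rightarrow> 'a set" where
  "saturation F A = (\<Union>x\<in>A. element_of F x)"

text \<open>The quotient map \<open>q\<close> from \<open>X\<close> to \<open>X/F\<close> is \<open>element_of F\<close>.\<close>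

definition decomposition_space :: "'a topology \<Rightarrow> 'a set set \<Rightarrow> 'a set topology" where
  "decomposition_space X F = quotient_topology X (element_of F)"

definition quotient_preimage :: "'a topology \<Rightarrow> 'a set set \<Rightarrow> 'a set set \<Rightarrow> 'a set" where
  "quotient_preimage X F C = {x \<in> topspace X. element_of F x \<in> C}"

definition invariant_decomposition :: "'a topology \<Rightarrow> 'a set set \<Rightarrow> bool" where
  "invariant_decomposition X F \<longleftrightarrow>
     decomposition X F \<and> (\<forall>U. openin X U \<longrightarrow> openin X (saturation F U))"

definition class_decomposition :: "'a topology \<Rightarrow> 'a set set \<Rightarrow> 'a set set" where
  "class_decomposition X F =
     (\<lambda>L. {x \<in> topspace X. X closure_of element_of F x = X closure_of L}) ` F"

definition class_invariant :: "'a topology \<Rightarrow> 'a set set \<Rightarrow> 'a set \<Rightarrow> bool" where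
  "class_invariant X F A \<longleftrightarrow> (\<exists>B \<subseteq> class_decomposition X F. A = \<Union>B)"

definition coborder :: "'a topology \<Rightarrow> 'a set \<Rightarrow> 'a set" where
  "coborder X L = X closure_of L - L"

definition closed_element :: "'a topology \<Rightarrow> 'a set \<Rightarrow> bool" where
  "closed_element X L \<longleftrightarrow> X closure_of L = L"

definition proper_element :: "'a topology \<Rightarrow> 'a set \<Rightarrow> bool" where
  "proper_element X L \<longleftrightarrow> closedin X (coborder X L)"

definition Cl_set :: "'a topology \<Rightarrow> 'a set set \<Rightarrow> 'a set" where
  "Cl_set X F = \<Union>{L \<in> F. closed_element X L}"

definition P_set :: "'a topology \<Rightarrow> 'a set set \<Rightarrow> 'a set" where
  "P_set X F = \<Union>{L \<in> F. \<not> closed_element X L \<and> proper_element X L}"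

definition R_set :: "'a topology \<Rightarrow> 'a set set \<Rightarrow> 'a set" where
  "R_set X F = \<Union>{L \<in> F. \<not> proper_element X L}"

definition recurrent_set :: "'a topology \<Rightarrow> 'a set set \<Rightarrow> 'a set" where
  "recurrent_set X F = Cl_set X F \<union> R_set X F"


section \<open>Abstract elements and abstract weak elements\<close>

text \<open>For a decomposition, every \<open>L \<in> F\<close> is non-empty and is contained either in
  \<open>Cl_set X F \<union> P_set X F\<close> or in \<open>R_set X F\<close>, so the \<open>else\<close> branches are the case
  \<open>L \<subseteq> R_set X F\<close>.\<close>

definition abstract_element :: "'a topology \<Rightarrow> 'a set set \<Rightarrow> 'a set \<Rightarrow> 'a set" where
  "abstract_element X F L =
     quotient_preimage X F
       (connected_component_of_set
          (subtopology (decomposition_space X F)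
             (if L \<subseteq> Cl_set X F \<union> P_set X F
              then {L' \<in> F. coborder X L = coborder X L'}
              else {L' \<in> F. X closure_of L = X closure_of L'}))
          L)"

definition abstract_weak_element :: "'a topology \<Rightarrow> 'a set set \<Rightarrow> 'a set \<Rightarrow> 'a set" where
  "abstract_weak_element X F L =
     quotient_preimage X F
       (connected_component_of_set
          (subtopology (decomposition_space X F)
             (if L \<subseteq> Cl_set X F \<union> P_set X F
              then {L' \<in> F. coborder X L = coborder X L' \<and>
                            subtopology X L' homeomorphic_space subtopology X L}
              else {L' \<in> F. X closure_of L = X closure_of L' \<and>
                            subtopology X L' homeomorphic_space subtopology X L}))
          L)"

definition abstract_element_at :: "'a topology \<Rightarrow> 'a set set \<Rightarrow> 'a \<Rightarrow> 'a set" where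
  "abstract_element_at X F x = abstract_element X F (element_of F x)"

definition abstract_weak_element_at :: "'a topology \<Rightarrow> 'a set set \<Rightarrow> 'a \<Rightarrow> 'a set" where
  "abstract_weak_element_at X F x = abstract_weak_element X F (element_of F x)"

definition abstract_element_space :: "'a topology \<Rightarrow> 'a set set \<Rightarrow> 'a set topology" where
  "abstract_element_space X F = quotient_topology X (abstract_element_at X F)"

definition abstract_weak_element_space :: "'a topology \<Rightarrow> 'a set set \<Rightarrow> 'a set topology" where
  "abstract_weak_element_space X F = quotient_topology X (abstract_weak_element_at X F)"


section \<open>The Morse hyper-graph\<close>

definition non_maximal :: "'a topology \<Rightarrow> 'a set set \<Rightarrow> 'a \<Rightarrow> bool" where
  "non_maximal X F x \<longleftrightarrow>
     (\<exists>y \<in> topspace X. X closure_of element_of F x \<subset> X closure_of element_of F y)"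

definition quasi_recurrent_set :: "'a topology \<Rightarrow> 'a set set \<Rightarrow> 'a set" where
  "quasi_recurrent_set X F =
     {x \<in> topspace X. \<exists>y \<in> abstract_element_at X F x. y \<in> recurrent_set X F \<or> non_maximal X F y}"

definition morse_vertices :: "'a topology \<Rightarrow> 'a set set \<Rightarrow> 'a set set" where
  "morse_vertices X F =
     quotient_preimage X F `
       connected_components_of
         (subtopology (decomposition_space X F) (element_of F ` quasi_recurrent_set X F))"

text \<open>The family of vertices is indexed by itself, so an index set \<open>I\<close> is a set of vertices;
  it may be empty or infinite.\<close>

definition hyper_edge :: "'a topology \<Rightarrow> 'a set set \<Rightarrow> 'a set set \<Rightarrow> 'a set" where
  "hyper_edge X F I =
     {x \<in> topspace X - \<Union>(morse_vertices X F).
        \<exists>C. disjoint_family_on C I \<and>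
            (\<forall>M\<in>I. class_invariant X F (C M) \<and> C M \<noteq> {} \<and>
                   C M \<subseteq> coborder X (element_of F x) \<and> C M \<subseteq> M) \<and>
            coborder X (element_of F x) = (\<Union>M\<in>I. C M)}"

definition morse_hypergraph :: "'a topology \<Rightarrow> 'a set set \<Rightarrow> 'a set set \<times> 'a set set set" where
  "morse_hypergraph X F =
     (morse_vertices X F, {I. I \<subseteq> morse_vertices X F \<and> hyper_edge X F I \<noteq> {}})"

definition morse_decomposition :: "'a topology \<Rightarrow> 'a set set \<Rightarrow> 'a set set" where
  "morse_decomposition X F =
     fst (morse_hypergraph X F) \<union> hyper_edge X F ` snd (morse_hypergraph X F)"

definition morse_hypergraph_space :: "'a topology \<Rightarrow> 'a set set \<Rightarrow> 'a set topology" where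
  "morse_hypergraph_space X F = decomposition_space X (morse_decomposition X F)"

end

theory Submission
  imports Defs
begin

text \<open>
  The quotient spaces in the theorem are all quotients of \<open>X\<close> itself, and a coarser partition of
  \<open>X\<close> always gives a quotient of a finer one (\<open>quotient_map_between_quotient_topologies\<close>). So the
  content is set-theoretic: the vertices and the non-empty hyper-edges partition \<open>X\<close>, and each
  abstract element lies in one part. Abstract weak elements are smaller than abstract elements,
  hence are covered as well.

  The key observation is that two different elements with the same closure are non-proper
  (\<open>not_proper_if_equal_closures\<close>): each is contained in the other's coborder, which is therefore
  dense in the common closure without being all of it, so it cannot be closed. This makes the two defining conditions of abstract elements consistent
  with each other, so that the abstract elements form a partition
  (\<open>abstract_element_at_eq\<close>) and the quasi-recurrent set \<open>Q\<close> is a union of them.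

  Let \<open>x\<close> be a point. If \<open>x\<close> is in \<open>Q\<close>, then its abstract element is a connected set of elements
  inside \<open>Q\<close>, so it lies in one component, that is, in one vertex. If \<open>x\<close> is outside \<open>Q\<close>, then
  every element in its abstract element is proper and has the same coborder, and membership in a
  hyper-edge depends on the coborder only.

  It remains to see that a point \<open>x\<close> outside \<open>Q\<close> lies in exactly one hyper-edge. The only possible
  index set consists of the vertices that meet the coborder of the element of \<open>x\<close>. It does occur:
  the coborder is closed, and by invariance of the decomposition it contains the closure of every
  element that it meets. Those closures miss \<open>x\<close>, so the points of the coborder are non-maximal and
  lie in \<open>Q\<close>; and the traces of the vertices on the coborder are unions of classes,
  because elements with equal closures are indistinguishable in the decomposition space and so
  lie in the same component (\<open>connectedin_equal_closures\<close>).
\<close>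

section \<open>Elements of a decomposition\<close>

lemma element_of_eq:
  assumes "decomposition X F" "L \<in> F" "x \<in> L"
  shows "element_of F x = L"
  unfolding element_of_def
proof (rule the_equality)
  show "L' = L" if "L' \<in> F \<and> x \<in> L'" for L'
    using assms that unfolding decomposition_def partition_on_def disjoint_def by blast
qed (use assms in blast)

lemma element_of_mem:
  assumes "decomposition X F" "x \<in> topspace X"
  shows "element_of F x \<in> F" "x \<in> element_of F x"
proof -
  obtain L where "L \<in> F" "x \<in> L"
    using assms unfolding decomposition_def partition_on_def by blast
  then show "element_of F x \<in> F" "x \<in> element_of F x"
    using element_of_eq[OF assms(1)] by auto
qed

lemma element_subset_topspace:
  assumes "decomposition X F" "L \<in> F"
  shows "L \<subseteq> topspace X"
  using assms unfolding decomposition_def partition_on_def by blast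

lemma element_nonempty:
  assumes "decomposition X F" "L \<in> F"
  obtains x where "x \<in> L" "x \<in> topspace X" "element_of F x = L"
proof -
  have "L \<noteq> {}"
    using assms unfolding decomposition_def partition_on_def by auto
  then obtain x where x: "x \<in> L"
    by blast
  with assms show thesis
    using that[of x] element_of_eq[OF assms x] element_subset_topspace[OF assms] by auto
qed

lemma topspace_decomposition_space:
  assumes "decomposition X F"
  shows "topspace (decomposition_space X F) = F"
  unfolding decomposition_space_def topspace_quotient_topology
  using element_of_mem[OF assms] element_nonempty[OF assms] by (metis image_iff subsetI subset_antisym)

lemma quotient_preimage_Union_components:
  assumes "decomposition X F" "S \<subseteq> F"
  shows "\<Union> (quotient_preimage X F ` connected_components_of (subtopology (decomposition_space X F) S))
    = quotient_preimage X F S"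
proof -
  have "\<Union> (connected_components_of (subtopology (decomposition_space X F) S)) = S"
    using assms by (simp add: Union_connected_components_of topspace_decomposition_space Int_absorb1)
  then show ?thesis
    unfolding quotient_preimage_def by blast
qed

section \<open>Closures of elements\<close>

lemma subset_closure_of_element:
  assumes "decomposition X F" "L \<in> F"
  shows "L \<subseteq> X closure_of L"
  using assms by (simp add: closure_of_subset element_subset_topspace)

text \<open>Invariance says that saturations of open sets are open. Hence closures of elements are unions
  of elements, and the specialisation order on points descends to elements.\<close>

lemma closure_of_element_mono:
  assumes inv: "invariant_decomposition X F" and L: "L \<in> F" and y: "y \<in> X closure_of L"
  shows "X closure_of element_of F y \<subseteq> X closure_of L"
proof (rule closure_of_minimal)
  have dec: "decomposition X F"
    using inv by (simp add: invariant_decomposition_def)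
  have yX: "y \<in> topspace X"
    using y by (simp add: in_closure_of)
  note Fy = element_of_mem[OF dec yX]
  show "element_of F y \<subseteq> X closure_of L"
  proof
    fix z assume z: "z \<in> element_of F y"
    then have Fz: "element_of F z = element_of F y"
      by (rule element_of_eq[OF dec Fy(1)])
    have "\<exists>w. w \<in> L \<and> w \<in> T" if "z \<in> T" "openin X T" for T
    proof -
      have "openin X (saturation F T)"
        using inv that by (simp add: invariant_decomposition_def)
      moreover have "y \<in> saturation F T"
        unfolding saturation_def using that Fz Fy by auto
      ultimately obtain w where "w \<in> L" "w \<in> saturation F T"
        using y unfolding in_closure_of by blast
      then obtain t where t: "t \<in> T" "w \<in> element_of F t"
        unfolding saturation_def by blast
      then have "t \<in> topspace X"
        using that openin_subset by blast
      then have "element_of F t = L" "t \<in> element_of F t"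
        using element_of_mem[OF dec] element_of_eq[OF dec] t \<open>w \<in> L\<close> L by metis+
      then show ?thesis
        using t by blast
    qed
    moreover have "z \<in> topspace X"
      using z Fy element_subset_topspace[OF dec] by blast
    ultimately show "z \<in> X closure_of L"
      by (auto simp: in_closure_of)
  qed
qed simp

lemma not_proper_if_equal_closures:
  assumes dec: "decomposition X F" and L: "L \<in> F" "L' \<in> F" "L \<noteq> L'"
    and eq: "X closure_of L = X closure_of L'"
  shows "\<not> proper_element X L"
proof
  assume "proper_element X L"
  moreover have "L \<inter> L' = {}"
    using dec L unfolding decomposition_def partition_on_def disjoint_def by blast
  then have "L' \<subseteq> coborder X L"
    using subset_closure_of_element[OF dec L(2)] eq unfolding coborder_def by blast
  ultimately have "X closure_of L' \<subseteq> coborder X L"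
    by (simp add: closure_of_minimal proper_element_def)
  then have "L \<subseteq> coborder X L"
    using subset_closure_of_element[OF dec L(1)] eq by blast
  then show False
    using element_nonempty[OF dec L(1)] unfolding coborder_def by blast
qed

text \<open>Elements with equal closures lie in the same open sets of the decomposition space, so that no
  separation can tell them apart.\<close>

lemma connectedin_equal_closures:
  assumes dec: "decomposition X F" and L: "L \<in> F" "L' \<in> F"
    and eq: "X closure_of L = X closure_of L'"
  shows "connectedin (decomposition_space X F) {L, L'}"
proof -
  have *: "B \<in> U"
    if U: "openin (decomposition_space X F) U" and AB: "A \<in> F" "B \<in> F" "A \<in> U"
      "X closure_of A = X closure_of B" for A B U
  proof -
    obtain x where x: "x \<in> A" "x \<in> topspace X" "element_of F x = A"
      using element_nonempty[OF dec AB(1)] .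
    have "openin X {x \<in> topspace X. element_of F x \<in> U}"
      using U by (simp add: decomposition_space_def openin_quotient_topology)
    moreover have "x \<in> X closure_of B"
      using AB(4) x(1) subset_closure_of_element[OF dec AB(1)] by auto
    moreover have "x \<in> {x \<in> topspace X. element_of F x \<in> U}"
      using x AB(3) by simp
    ultimately have "\<exists>y\<in>B. y \<in> {x \<in> topspace X. element_of F x \<in> U}"
      by (meson in_closure_of)
    then obtain y where "y \<in> B" "element_of F y \<in> U"
      by blast
    then show ?thesis
      using element_of_eq[OF dec AB(2)] by simp
  qed
  have "L \<in> U \<longleftrightarrow> L' \<in> U" if "openin (decomposition_space X F) U" for U
    using *[OF that] L eq by metis
  then show ?thesis
    unfolding connectedin using L topspace_decomposition_space[OF dec] by blast
qed

section \<open>Abstract elements as equivalence classes\<close>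

text \<open>The set of elements whose component defines the abstract element, with the case distinction
  expressed through properness of the element alone.\<close>

definition abstract_class :: "'a topology \<Rightarrow> 'a set set \<Rightarrow> 'a set \<Rightarrow> 'a set set" where
  "abstract_class X F L =
     (if proper_element X L
      then {L' \<in> F. coborder X L = coborder X L'}
      else {L' \<in> F. X closure_of L = X closure_of L'})"

lemma subset_Cl_P_iff_proper:
  assumes dec: "decomposition X F" and L: "L \<in> F"
  shows "L \<subseteq> Cl_set X F \<union> P_set X F \<longleftrightarrow> proper_element X L"
proof
  assume "proper_element X L"
  then show "L \<subseteq> Cl_set X F \<union> P_set X F"
    unfolding Cl_set_def P_set_def using L by blast
next
  assume sub: "L \<subseteq> Cl_set X F \<union> P_set X F"
  obtain x where "x \<in> L"
    using element_nonempty[OF dec L] .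
  with sub obtain L' where "L' \<in> F" "x \<in> L'" and L': "closed_element X L' \<or> proper_element X L'"
    unfolding Cl_set_def P_set_def by blast
  then have "L' = L"
    using element_of_eq[OF dec] L \<open>x \<in> L\<close> by metis
  moreover have "proper_element X L" if "closed_element X L"
    using that by (simp add: closed_element_def proper_element_def coborder_def)
  ultimately show "proper_element X L"
    using L' by blast
qed

lemma abstract_element_eq_component:
  assumes "decomposition X F" "L \<in> F"
  shows "abstract_element X F L = quotient_preimage X F
    (connected_component_of_set (subtopology (decomposition_space X F) (abstract_class X F L)) L)"
  unfolding abstract_element_def abstract_class_def subset_Cl_P_iff_proper[OF assms] ..

lemma abstract_class_subset: "abstract_class X F L \<subseteq> F"
  by (auto simp: abstract_class_def)

lemma abstract_class_refl: "L \<in> F \<Longrightarrow> L \<in> abstract_class X F L"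
  by (simp add: abstract_class_def)

text \<open>Equal coborders preserve properness trivially, equal closures by
  \<open>not_proper_if_equal_closures\<close>; so the same branch of the definition applies throughout a class.\<close>

lemma abstract_class_eq:
  assumes dec: "decomposition X F" and L: "L \<in> F" "L' \<in> abstract_class X F L"
  shows "abstract_class X F L' = abstract_class X F L"
    and "proper_element X L' \<longleftrightarrow> proper_element X L"
proof -
  show p: "proper_element X L' \<longleftrightarrow> proper_element X L"
  proof (cases "proper_element X L")
    case True
    then show ?thesis
      using L by (simp add: abstract_class_def proper_element_def)
  next
    case False
    then show ?thesis
      using L not_proper_if_equal_closures[OF dec, of L' L] by (auto simp: abstract_class_def)
  qed
  show "abstract_class X F L' = abstract_class X F L"
    using L p by (auto simp: abstract_class_def split: if_splits)
qed

lemma abstract_element_at_class: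
  assumes dec: "decomposition X F" and x: "x \<in> topspace X" and y: "y \<in> abstract_element_at X F x"
  shows "y \<in> topspace X" "element_of F y \<in> abstract_class X F (element_of F x)"
    and "connected_component_of (subtopology (decomposition_space X F)
           (abstract_class X F (element_of F x))) (element_of F x) (element_of F y)"
proof -
  let ?S = "subtopology (decomposition_space X F) (abstract_class X F (element_of F x))"
  show "y \<in> topspace X" and c: "connected_component_of ?S (element_of F x) (element_of F y)"
    using y element_of_mem[OF dec x]
    by (auto simp: abstract_element_at_def abstract_element_eq_component[OF dec] quotient_preimage_def)
  show "element_of F y \<in> abstract_class X F (element_of F x)"
    using connected_component_in_topspace[OF c] by simp
qed

lemma abstract_element_at_self:
  assumes dec: "decomposition X F" and x: "x \<in> topspace X"
  shows "x \<in> abstract_element_at X F x"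
  using x element_of_mem[OF dec x] abstract_class_refl
  by (auto simp: abstract_element_at_def abstract_element_eq_component[OF dec] quotient_preimage_def
      connected_component_of_refl topspace_decomposition_space[OF dec])

lemma abstract_element_at_eq:
  assumes dec: "decomposition X F" and x: "x \<in> topspace X" and y: "y \<in> abstract_element_at X F x"
  shows "abstract_element_at X F y = abstract_element_at X F x"
proof -
  note c = abstract_element_at_class[OF assms]
  note Fx = element_of_mem(1)[OF dec x] and Fy = element_of_mem(1)[OF dec c(1)]
  have "abstract_class X F (element_of F y) = abstract_class X F (element_of F x)"
    by (rule abstract_class_eq(1)[OF dec Fx c(2)])
  moreover have "connected_component_of_set
        (subtopology (decomposition_space X F) (abstract_class X F (element_of F x))) (element_of F x)
     = connected_component_of_set
        (subtopology (decomposition_space X F) (abstract_class X F (element_of F x))) (element_of F y)"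
    using c(3) by (simp add: connected_component_of_equiv)
  ultimately show ?thesis
    by (simp add: abstract_element_at_def abstract_element_eq_component[OF dec] Fx Fy)
qed

text \<open>The homeomorphism condition shrinks the set of candidates, and components can only shrink
  with it.\<close>

lemma abstract_weak_element_at_subset:
  "abstract_weak_element_at X F x \<subseteq> abstract_element_at X F x"
proof -
  let ?comp = "\<lambda>S. connected_component_of_set (subtopology (decomposition_space X F) S) (element_of F x)"
  have mono: "quotient_preimage X F (?comp S) \<subseteq> quotient_preimage X F (?comp T)" if "S \<subseteq> T" for S T
    using connected_component_of_mono[OF _ that] unfolding quotient_preimage_def by blast
  show ?thesis
    unfolding abstract_weak_element_at_def abstract_weak_element_def
      abstract_element_at_def abstract_element_def
    by (rule mono) auto
qed

lemma abstract_weak_element_at_self: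
  assumes dec: "decomposition X F" and x: "x \<in> topspace X"
  shows "x \<in> abstract_weak_element_at X F x"
  using x element_of_mem[OF dec x] homeomorphic_space_refl
  by (auto simp: abstract_weak_element_at_def abstract_weak_element_def quotient_preimage_def
      connected_component_of_refl topspace_decomposition_space[OF dec])

section \<open>The quasi-recurrent set and the vertices\<close>

lemma quasi_recurrent_set_abstract_element:
  assumes dec: "decomposition X F" and x: "x \<in> topspace X" and y: "y \<in> abstract_element_at X F x"
  shows "y \<in> quasi_recurrent_set X F \<longleftrightarrow> x \<in> quasi_recurrent_set X F"
  using abstract_element_at_eq[OF assms] abstract_element_at_class(1)[OF assms] x
  by (simp add: quasi_recurrent_set_def)

lemma quasi_recurrent_setI:
  assumes "decomposition X F" "x \<in> topspace X" "x \<in> recurrent_set X F \<or> non_maximal X F x"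
  shows "x \<in> quasi_recurrent_set X F"
  unfolding quasi_recurrent_set_def
  using assms(2,3) abstract_element_at_self[OF assms(1,2)] by blast

lemma quasi_recurrent_if_not_proper:
  assumes "decomposition X F" "x \<in> topspace X" "\<not> proper_element X (element_of F x)"
  shows "x \<in> quasi_recurrent_set X F"
  using assms element_of_mem[OF assms(1,2)]
  by (intro quasi_recurrent_setI) (auto simp: recurrent_set_def R_set_def)

lemma quasi_recurrent_set_saturated:
  assumes "x \<in> topspace X" "element_of F x \<in> element_of F ` quasi_recurrent_set X F"
  shows "x \<in> quasi_recurrent_set X F"
  using assms unfolding quasi_recurrent_set_def abstract_element_at_def by auto

lemma quasi_recurrent_elements_subset:
  assumes "decomposition X F"
  shows "element_of F ` quasi_recurrent_set X F \<subseteq> F"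
  using element_of_mem[OF assms] unfolding quasi_recurrent_set_def by blast

lemma Union_morse_vertices:
  assumes dec: "decomposition X F"
  shows "\<Union> (morse_vertices X F) = quasi_recurrent_set X F"
proof -
  have "quasi_recurrent_set X F \<subseteq> topspace X"
    by (auto simp: quasi_recurrent_set_def)
  then have "quotient_preimage X F (element_of F ` quasi_recurrent_set X F) = quasi_recurrent_set X F"
    using quasi_recurrent_set_saturated[of _ X F] unfolding quotient_preimage_def by blast
  then show ?thesis
    unfolding morse_vertices_def
    using quotient_preimage_Union_components[OF dec quasi_recurrent_elements_subset[OF dec]] by simp
qed

lemma morse_vertices_nonempty:
  assumes dec: "decomposition X F" and M: "M \<in> morse_vertices X F"
  shows "M \<noteq> {}"
proof -
  obtain C where C: "M = quotient_preimage X F C"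
    and comp: "C \<in> connected_components_of
      (subtopology (decomposition_space X F) (element_of F ` quasi_recurrent_set X F))"
    using M unfolding morse_vertices_def by blast
  obtain L where "L \<in> C"
    using nonempty_connected_components_of[OF comp] by blast
  then have "L \<in> F"
    using connected_components_of_subset[OF comp] quasi_recurrent_elements_subset[OF dec] by auto
  then show ?thesis
    using element_nonempty[OF dec] \<open>L \<in> C\<close> unfolding C quotient_preimage_def by blast
qed

lemma morse_vertices_disjoint:
  assumes "M \<in> morse_vertices X F" "M' \<in> morse_vertices X F" "x \<in> M" "x \<in> M'"
  shows "M = M'"
proof -
  let ?T = "subtopology (decomposition_space X F) (element_of F ` quasi_recurrent_set X F)"
  obtain C C' where C: "C \<in> connected_components_of ?T" "M = quotient_preimage X F C"
    and C': "C' \<in> connected_components_of ?T" "M' = quotient_preimage X F C'"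
    using assms unfolding morse_vertices_def by blast
  then have "\<not> disjnt C C'"
    using assms by (auto simp: quotient_preimage_def disjnt_def)
  then have "C = C'"
    using pairwise_disjoint_connected_components_of[of ?T] C(1) C'(1) by (meson pairwiseD)
  then show ?thesis
    using C C' by simp
qed

lemma morse_vertex_if_connectedin:
  assumes M: "M \<in> morse_vertices X F" and x: "x \<in> M" and y: "y \<in> topspace X"
    and S: "connectedin (decomposition_space X F) S" "element_of F x \<in> S" "element_of F y \<in> S"
    and sub: "S \<subseteq> element_of F ` quasi_recurrent_set X F"
  shows "y \<in> M"
proof -
  let ?T = "subtopology (decomposition_space X F) (element_of F ` quasi_recurrent_set X F)"
  obtain C where C: "C \<in> connected_components_of ?T" "M = quotient_preimage X F C"
    using M unfolding morse_vertices_def by blast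
  have "element_of F x \<in> C"
    using x C by (simp add: quotient_preimage_def)
  then have "\<not> disjnt C S"
    using S by (auto simp: disjnt_def)
  then have "S \<subseteq> C"
    using connected_components_of_maximal[OF C(1)] S sub by (simp add: connectedin_subtopology)
  then show ?thesis
    using C S y by (auto simp: quotient_preimage_def)
qed

lemma abstract_element_at_subset_vertex:
  assumes dec: "decomposition X F" and M: "M \<in> morse_vertices X F" and x: "x \<in> M"
  shows "abstract_element_at X F x \<subseteq> M"
proof
  fix y assume y: "y \<in> abstract_element_at X F x"
  have xQ: "x \<in> quasi_recurrent_set X F"
    using M x Union_morse_vertices[OF dec] by blast
  then have xX: "x \<in> topspace X"
    by (simp add: quasi_recurrent_set_def)
  note c = abstract_element_at_class[OF dec xX]
  let ?S = "connected_component_of_set (subtopology (decomposition_space X F)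
    (abstract_class X F (element_of F x))) (element_of F x)"
  show "y \<in> M"
  proof (rule morse_vertex_if_connectedin[OF M x, where S = ?S])
    show "connectedin (decomposition_space X F) ?S"
      using connectedin_connected_component_of[of "subtopology (decomposition_space X F)
          (abstract_class X F (element_of F x))"]
      by (simp add: connectedin_subtopology)
    show "?S \<subseteq> element_of F ` quasi_recurrent_set X F"
    proof
      fix L assume "L \<in> ?S"
      moreover from this have "L \<in> F"
        using connected_component_in_topspace[of _ _ L] abstract_class_subset by fastforce
      then obtain z where z: "z \<in> topspace X" "element_of F z = L"
        using element_nonempty[OF dec] by metis
      ultimately have "z \<in> abstract_element_at X F x"
        by (simp add: abstract_element_at_def abstract_element_eq_component[OF dec]
            element_of_mem[OF dec xX] quotient_preimage_def)
      then show "L \<in> element_of F ` quasi_recurrent_set X F"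
        using quasi_recurrent_set_abstract_element[OF dec xX] xQ z by blast
    qed
    show "element_of F x \<in> ?S"
      using c(3)[OF abstract_element_at_self[OF dec xX]] by simp
  qed (use c[OF y] in auto)
qed

text \<open>Only non-proper elements have a class with further members, and those members are then again
  non-proper, hence recurrent and indistinguishable from the given element.\<close>

lemma morse_vertex_class_closed:
  assumes dec: "decomposition X F" and M: "M \<in> morse_vertices X F" and x: "x \<in> M"
    and y: "y \<in> topspace X" and eq: "X closure_of element_of F y = X closure_of element_of F x"
  shows "y \<in> M"
proof -
  have xQ: "x \<in> quasi_recurrent_set X F"
    using M x Union_morse_vertices[OF dec] by blast
  then have xX: "x \<in> topspace X"
    by (simp add: quasi_recurrent_set_def)
  note F = element_of_mem(1)[OF dec xX] element_of_mem(1)[OF dec y]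
  have yQ: "y \<in> quasi_recurrent_set X F"
  proof (cases "element_of F x = element_of F y")
    case True
    then show ?thesis
      using xQ y by (metis quasi_recurrent_set_saturated image_eqI)
  next
    case False
    then have "\<not> proper_element X (element_of F y)"
      using not_proper_if_equal_closures[OF dec F(2,1)] eq by simp
    then show ?thesis
      by (rule quasi_recurrent_if_not_proper[OF dec y])
  qed
  show ?thesis
    by (rule morse_vertex_if_connectedin[OF M x y connectedin_equal_closures[OF dec F eq[symmetric]]])
      (use xQ yQ in auto)
qed

section \<open>The hyper-edges\<close>

lemma class_invariantI:
  assumes dec: "decomposition X F" and sub: "A \<subseteq> topspace X"
    and A: "\<And>x y. \<lbrakk>x \<in> A; y \<in> topspace X; X closure_of element_of F y = X closure_of element_of F x\<rbrakk>
      \<Longrightarrow> y \<in> A"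
  shows "class_invariant X F A"
  unfolding class_invariant_def
proof (intro exI conjI)
  let ?cls = "\<lambda>L. {x \<in> topspace X. X closure_of element_of F x = X closure_of L}"
  let ?B = "(\<lambda>x. ?cls (element_of F x)) ` A"
  show "?B \<subseteq> class_decomposition X F"
    unfolding class_decomposition_def using element_of_mem[OF dec] sub by blast
  show "A = \<Union> ?B"
    using A sub by blast
qed

text \<open>A disjoint family with \<open>C M \<subseteq> M\<close> that exhausts the coborder must consist of the traces
  \<open>M \<inter> coborder\<close>, as the vertices are disjoint; non-emptiness then determines the index set.\<close>

lemma hyper_edge_index:
  assumes I: "I \<subseteq> morse_vertices X F" and x: "x \<in> hyper_edge X F I"
  shows "I = {M \<in> morse_vertices X F. M \<inter> coborder X (element_of F x) \<noteq> {}}"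
proof -
  let ?K = "coborder X (element_of F x)"
  obtain C where "\<forall>M\<in>I. class_invariant X F (C M) \<and> C M \<noteq> {} \<and> C M \<subseteq> ?K \<and> C M \<subseteq> M"
    and K: "?K = (\<Union>M\<in>I. C M)"
    using x unfolding hyper_edge_def by (elim CollectE conjE exE)
  then have C: "C M \<noteq> {} \<and> C M \<subseteq> ?K \<and> C M \<subseteq> M" if "M \<in> I" for M
    using that by simp
  have "M \<in> I" if "M \<in> morse_vertices X F" "M \<inter> ?K \<noteq> {}" for M
  proof -
    from that(2) obtain z where z: "z \<in> M" "z \<in> ?K"
      by blast
    then obtain M' where M': "M' \<in> I" "z \<in> C M'"
      unfolding K by blast
    then have "M = M'"
      using C z that I by (intro morse_vertices_disjoint[of M X F M' z]) auto
    then show ?thesis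
      using M' by simp
  qed
  moreover have "M \<inter> ?K \<noteq> {}" if "M \<in> I" for M
    using C[OF that] by blast
  ultimately show ?thesis
    using I by blast
qed

text \<open>For a proper element the coborder is closed, so it contains the closures of the elements that
  it meets. These closures miss the given element and are therefore strictly smaller than its
  closure, which makes every point of the coborder non-maximal.\<close>

lemma coborder_subset_quasi_recurrent_set:
  assumes inv: "invariant_decomposition X F" and x: "x \<in> topspace X"
    and p: "proper_element X (element_of F x)" and z: "z \<in> coborder X (element_of F x)"
  shows "z \<in> quasi_recurrent_set X F" "X closure_of element_of F z \<subseteq> coborder X (element_of F x)"
proof -
  have dec: "decomposition X F"
    using inv by (simp add: invariant_decomposition_def)
  let ?L = "element_of F x"
  note L = element_of_mem[OF dec x]
  have zL: "z \<in> X closure_of ?L" "z \<notin> ?L"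
    using z by (auto simp: coborder_def)
  then have zX: "z \<in> topspace X"
    by (simp add: in_closure_of)
  note Fz = element_of_mem[OF dec zX]
  have sub: "X closure_of element_of F z \<subseteq> X closure_of ?L"
    by (rule closure_of_element_mono[OF inv L(1) zL(1)])
  have "element_of F z \<inter> ?L = {}"
    using element_of_eq[OF dec L(1)] element_of_eq[OF dec Fz(1)] Fz(2) zL(2) by blast
  then have "element_of F z \<subseteq> coborder X ?L"
    using sub subset_closure_of_element[OF dec Fz(1)] unfolding coborder_def by blast
  then show cl: "X closure_of element_of F z \<subseteq> coborder X ?L"
    using p by (simp add: closure_of_minimal proper_element_def)
  have "X closure_of element_of F z \<noteq> X closure_of ?L"
    using cl L(2) subset_closure_of_element[OF dec L(1)] unfolding coborder_def by blast
  then have "non_maximal X F z"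
    unfolding non_maximal_def using sub x by blast
  then show "z \<in> quasi_recurrent_set X F"
    using quasi_recurrent_setI[OF dec zX] by blast
qed

lemma mem_hyper_edge:
  assumes inv: "invariant_decomposition X F" and x: "x \<in> topspace X"
    and nQ: "x \<notin> quasi_recurrent_set X F"
  shows "x \<in> hyper_edge X F {M \<in> morse_vertices X F. M \<inter> coborder X (element_of F x) \<noteq> {}}"
proof -
  have dec: "decomposition X F"
    using inv by (simp add: invariant_decomposition_def)
  let ?K = "coborder X (element_of F x)"
  let ?I = "{M \<in> morse_vertices X F. M \<inter> ?K \<noteq> {}}"
  let ?C = "\<lambda>M. M \<inter> ?K"
  have p: "proper_element X (element_of F x)"
    using quasi_recurrent_if_not_proper[OF dec x] nQ by blast
  note K = coborder_subset_quasi_recurrent_set[OF inv x p]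
  have "disjoint_family_on ?C ?I"
    unfolding disjoint_family_on_def using morse_vertices_disjoint[of _ X F] by auto
  moreover have "class_invariant X F (?C M)" if "M \<in> morse_vertices X F" for M
  proof (rule class_invariantI[OF dec])
    show "?C M \<subseteq> topspace X"
      using K(1) by (auto simp: quasi_recurrent_set_def)
    show "b \<in> ?C M" if ab: "a \<in> ?C M" "b \<in> topspace X"
      "X closure_of element_of F b = X closure_of element_of F a" for a b
    proof -
      have "b \<in> X closure_of element_of F b"
        using ab element_of_mem[OF dec] subset_closure_of_element[OF dec] by blast
      then have "b \<in> ?K"
        using K(2)[of a] ab by auto
      moreover have "b \<in> M"
        using morse_vertex_class_closed[OF dec \<open>M \<in> morse_vertices X F\<close>, of a b] ab by simp
      ultimately show ?thesis
        by simp
    qed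
  qed
  moreover have "?K = (\<Union>M\<in>?I. ?C M)"
    using K(1) Union_morse_vertices[OF dec] by blast
  ultimately show ?thesis
    unfolding hyper_edge_def using x nQ Union_morse_vertices[OF dec] by blast
qed

text \<open>A hyper-edge sees a point only through the coborder of its element, and the coborder is
  constant on an abstract element of proper elements.\<close>

lemma abstract_element_at_subset_hyper_edge:
  assumes dec: "decomposition X F" and x: "x \<in> hyper_edge X F I"
  shows "abstract_element_at X F x \<subseteq> hyper_edge X F I"
proof
  fix y assume y: "y \<in> abstract_element_at X F x"
  have xX: "x \<in> topspace X" and nQ: "x \<notin> quasi_recurrent_set X F"
    using x Union_morse_vertices[OF dec] by (auto simp: hyper_edge_def)
  have "proper_element X (element_of F x)"
    using quasi_recurrent_if_not_proper[OF dec xX] nQ by blast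
  then have "coborder X (element_of F y) = coborder X (element_of F x)"
    using abstract_element_at_class(2)[OF dec xX y] by (simp add: abstract_class_def)
  moreover have "y \<in> topspace X" "y \<notin> \<Union> (morse_vertices X F)"
    using abstract_element_at_class(1)[OF dec xX y] nQ
      quasi_recurrent_set_abstract_element[OF dec xX y] Union_morse_vertices[OF dec] by simp_all
  ultimately show "y \<in> hyper_edge X F I"
    using x by (simp add: hyper_edge_def)
qed

section \<open>The Morse decomposition and its quotient space\<close>

lemma morse_decomposition_cases:
  assumes "D \<in> morse_decomposition X F"
  obtains (vertex) "D \<in> morse_vertices X F"
    | (edge) I where "I \<subseteq> morse_vertices X F" "D = hyper_edge X F I" "hyper_edge X F I \<noteq> {}"
  using assms unfolding morse_decomposition_def morse_hypergraph_def by auto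

lemma decomposition_morse_decomposition:
  assumes inv: "invariant_decomposition X F"
  shows "decomposition X (morse_decomposition X F)"
proof -
  have dec: "decomposition X F"
    using inv by (simp add: invariant_decomposition_def)
  let ?V = "morse_vertices X F"
  have Q: "\<Union> ?V = quasi_recurrent_set X F"
    by (rule Union_morse_vertices[OF dec])
  have "D \<subseteq> topspace X \<and> D \<noteq> {}" if "D \<in> morse_decomposition X F" for D
    using that
  proof (cases rule: morse_decomposition_cases)
    case vertex
    then show ?thesis
      using Q morse_vertices_nonempty[OF dec] by (auto simp: quasi_recurrent_set_def)
  next
    case (edge I)
    then show ?thesis
      by (auto simp: hyper_edge_def)
  qed
  moreover have "\<exists>D\<in>morse_decomposition X F. x \<in> D" if x: "x \<in> topspace X" for x
  proof (cases "x \<in> quasi_recurrent_set X F")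
    case True
    then show ?thesis
      using Q unfolding morse_decomposition_def morse_hypergraph_def by auto
  next
    case False
    let ?I = "{M \<in> ?V. M \<inter> coborder X (element_of F x) \<noteq> {}}"
    have "x \<in> hyper_edge X F ?I"
      by (rule mem_hyper_edge[OF inv x False])
    moreover from this have "hyper_edge X F ?I \<in> morse_decomposition X F"
      unfolding morse_decomposition_def morse_hypergraph_def by auto
    ultimately show ?thesis
      by blast
  qed
  moreover have "D = D'"
    if D: "D \<in> morse_decomposition X F" "D' \<in> morse_decomposition X F" "x \<in> D" "x \<in> D'" for D D' x
    using D(1)
  proof (cases rule: morse_decomposition_cases)
    case vertex
    note V = this
    show ?thesis
      using D(2)
    proof (cases rule: morse_decomposition_cases)
      case vertex
      then show ?thesis
        by (rule morse_vertices_disjoint[OF V _ D(3,4)])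
    next
      case (edge I)
      then show ?thesis
        using V D by (auto simp: hyper_edge_def)
    qed
  next
    case (edge I)
    note E = this
    show ?thesis
      using D(2)
    proof (cases rule: morse_decomposition_cases)
      case vertex
      then show ?thesis
        using E D by (auto simp: hyper_edge_def)
    next
      case (edge I')
      have x: "x \<in> hyper_edge X F I" "x \<in> hyper_edge X F I'"
        using E(2) edge(2) D(3,4) by simp_all
      have "I = I'"
        by (rule trans[OF hyper_edge_index[OF E(1) x(1)] hyper_edge_index[OF edge(1) x(2), symmetric]])
      then show ?thesis
        using E(2) edge(2) by simp
    qed
  qed
  ultimately show ?thesis
    unfolding decomposition_def partition_on_def disjoint_def by blast
qed

lemma abstract_element_at_subset_morse:
  assumes inv: "invariant_decomposition X F" and x: "x \<in> topspace X"
  shows "abstract_element_at X F x \<subseteq> element_of (morse_decomposition X F) x"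
proof -
  have dec: "decomposition X F"
    using inv by (simp add: invariant_decomposition_def)
  note D = element_of_mem[OF decomposition_morse_decomposition[OF inv] x]
  from D(1) show ?thesis
  proof (cases rule: morse_decomposition_cases)
    case vertex
    then show ?thesis
      using abstract_element_at_subset_vertex[OF dec] D(2) by blast
  next
    case (edge I)
    then show ?thesis
      using abstract_element_at_subset_hyper_edge[OF dec] D(2) by metis
  qed
qed

lemma quotient_map_between_quotient_topologies:
  assumes "\<And>x y. \<lbrakk>x \<in> topspace X; y \<in> topspace X; f x = f y\<rbrakk> \<Longrightarrow> g x = g y"
  shows "\<exists>p. quotient_map (quotient_topology X f) (quotient_topology X g) p \<and>
    (\<forall>x\<in>topspace X. p (f x) = g x)"
proof -
  note f = quotient_map_quotient_topology[of X f] and g = quotient_map_quotient_topology[of X g]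
  obtain p where p: "continuous_map (quotient_topology X f) (quotient_topology X g) p"
    and pf: "\<And>x. x \<in> topspace X \<Longrightarrow> p (f x) = g x"
    using quotient_map_lift_exists[OF f quotient_imp_continuous_map[OF g]] assms by metis
  have "quotient_map X (quotient_topology X g) (p \<circ> f)"
    using quotient_map_eq[OF g] pf by simp
  then have "quotient_map (quotient_topology X f) (quotient_topology X g) p"
    using quotient_map_from_composition quotient_imp_continuous_map[OF f] p by blast
  then show ?thesis
    using pf by blast
qed

text \<open>The theorem for any assignment of a set \<open>f x \<ni> x\<close> to each point, each such set lying
  in one part of the partition; \<open>f x = f y\<close> puts \<open>y\<close> into \<open>f x\<close> and so into the part of \<open>x\<close>.\<close>

lemma decomposition_space_quotient_if_subset:
  assumes dec: "decomposition X D"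
    and self: "\<And>x. x \<in> topspace X \<Longrightarrow> x \<in> f x"
    and sub: "\<And>x. x \<in> topspace X \<Longrightarrow> f x \<subseteq> element_of D x"
  shows "\<forall>x\<in>topspace X. \<exists>!A. A \<in> D \<and> f x \<subseteq> A"
    and "\<exists>p. quotient_map (quotient_topology X f) (decomposition_space X D) p \<and>
      (\<forall>x\<in>topspace X. p (f x) = element_of D x)"
proof -
  show "\<forall>x\<in>topspace X. \<exists>!A. A \<in> D \<and> f x \<subseteq> A"
  proof
    fix x assume x: "x \<in> topspace X"
    show "\<exists>!A. A \<in> D \<and> f x \<subseteq> A"
    proof (rule ex1I[of _ "element_of D x"])
      show "A = element_of D x" if "A \<in> D \<and> f x \<subseteq> A" for A
        using that self[OF x] element_of_eq[OF dec] by blast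
    qed (use x sub element_of_mem[OF dec] in blast)
  qed
  show "\<exists>p. quotient_map (quotient_topology X f) (decomposition_space X D) p \<and>
      (\<forall>x\<in>topspace X. p (f x) = element_of D x)"
    unfolding decomposition_space_def
  proof (rule quotient_map_between_quotient_topologies)
    fix x y assume xy: "x \<in> topspace X" "y \<in> topspace X" "f x = f y"
    then have "y \<in> element_of D x"
      using self sub by blast
    then show "element_of D x = element_of D y"
      using element_of_eq[OF dec] element_of_mem[OF dec] xy by metis
  qed
qed

theorem theorem7p9:
  fixes X :: "'a topology" and F :: "'a set set"
  assumes "invariant_decomposition X F"
  shows "decomposition X (morse_decomposition X F) \<and>
    (\<forall>x\<in>topspace X. \<exists>!D. D \<in> morse_decomposition X F \<and> abstract_element_at X F x \<subseteq> D) \<and>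
    (\<forall>x\<in>topspace X. \<exists>!D. D \<in> morse_decomposition X F \<and> abstract_weak_element_at X F x \<subseteq> D) \<and>
    (\<exists>p. quotient_map (abstract_element_space X F) (morse_hypergraph_space X F) p \<and>
         (\<forall>x\<in>topspace X. p (abstract_element_at X F x) = element_of (morse_decomposition X F) x)) \<and>
    (\<exists>p. quotient_map (abstract_weak_element_space X F) (morse_hypergraph_space X F) p \<and>
         (\<forall>x\<in>topspace X. p (abstract_weak_element_at X F x) = element_of (morse_decomposition X F) x))"
proof -
  have dec: "decomposition X F"
    using assms by (simp add: invariant_decomposition_def)
  note morse = decomposition_morse_decomposition[OF assms]
  note strong = abstract_element_at_subset_morse[OF assms]
  have weak: "abstract_weak_element_at X F x \<subseteq> element_of (morse_decomposition X F) x"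
    if "x \<in> topspace X" for x
    by (rule order_trans[OF abstract_weak_element_at_subset strong[OF that]])
  show ?thesis
    unfolding abstract_element_space_def abstract_weak_element_space_def morse_hypergraph_space_def
    by (intro conjI morse
        decomposition_space_quotient_if_subset[OF morse abstract_element_at_self[OF dec]]
        decomposition_space_quotient_if_subset[OF morse abstract_weak_element_at_self[OF dec]]
        strong weak)
qed

end
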